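(* If $f\in\mathfrak{D}(\mathbb{C}^+)$, then $f(z)\,[(\alpha^{-1})'(z)]^{1/2}\in H^2(\mathbb{C}^+)$; that is, the function $z\mapsto\frac{\sqrt{-2i}}{z+i}f(z)$ belongs to $H^2(\mathbb{C}^+)$.
   Context: $\mathbb{D}=\{w\in\mathbb{C}:|w|<1\}$ is the unit disc, $\mathbb{C}^+=\{z\in\mathbb{C}:\operatorname{Im} z>0\}$ is the upper half-plane, and $dA$ is Lebesgue area measure. The Dirichlet space $\mathfrak{D}(\mathbb{C}^+)$ consists of all analytic functions $f$ on $\mathbb{C}^+$ with $\int_{\mathbb{C}^+}|f'(z)|^2\,dA(z)<\infty$. The Hardy space $H^2(\mathbb{C}^+)$ consists of all analytic functions $f$ on $\mathbb{C}^+$ with $\|f\|_{H^2}=\sup_{y>0}\left(\int_{-\infty}^{\infty}|f(x+iy)|^2\,dx\right)^{1/2}<\infty$. The map $\alpha:\mathbb{D}\to\mathbb{C}^+$ is $\alpha(w)=i\frac{1-w}{1+w}$, with inverse $\alpha^{-1}(z)=\frac{i-z}{i+z}$, so $(\alpha^{-1})'(z)=\frac{-2i}{(z+i)^2}$, and $[(\alpha^{-1})'(z)]^{1/2}$ denotes the analytic branch $\frac{\sqrt{-2i}}{z+i}$, where $\sqrt{-2i}$ is a fixed square root of $-2i$. *)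

theory Defs
  imports "HOL-Complex_Analysis.Complex_Analysis"
begin

definition upper_half_plane :: "complex set" where
  "upper_half_plane = {z. Im z > 0}"

text \<open>Functions on the half-plane are total functions on the complex numbers whose values
  outside the half-plane are irrelevant: since the half-plane is open, \<open>deriv f\<close> there
  depends only on the restriction of \<open>f\<close>.\<close>

definition dirichlet_space :: "(complex \<Rightarrow> complex) set" where
  "dirichlet_space = {f. f holomorphic_on upper_half_plane \<and>
     (\<integral>\<^sup>+ z \<in> upper_half_plane. ennreal ((cmod (deriv f z))\<^sup>2) \<partial>lborel) < \<infinity>}"

definition ennreal_sqrt :: "ennreal \<Rightarrow> ennreal" where
  "ennreal_sqrt x = (if x = \<infinity> then \<infinity> else ennreal (sqrt (enn2real x)))"

definition hardy_norm :: "(complex \<Rightarrow> complex) \<Rightarrow> ennreal" where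
  "hardy_norm f =
     (SUP y \<in> {0<..}. ennreal_sqrt (\<integral>\<^sup>+ x. ennreal ((cmod (f (Complex x y)))\<^sup>2) \<partial>(lborel :: real measure)))"

definition hardy_space :: "(complex \<Rightarrow> complex) set" where
  "hardy_space = {f. f holomorphic_on upper_half_plane \<and> hardy_norm f < \<infinity>}"

definition alpha :: "complex \<Rightarrow> complex" where
  "alpha w = \<i> * (1 - w) / (1 + w)"

definition alpha_inv :: "complex \<Rightarrow> complex" where
  "alpha_inv z = (\<i> - z) / (\<i> + z)"

text \<open>With \<open>c\<close> a square root of \<open>- 2 \<i>\<close>, this is the analytic branch on the half-plane of
  the square root of \<open>deriv alpha_inv\<close>; see the last two lemmas below.\<close>

definition alpha_inv_deriv_root :: "complex \<Rightarrow> complex \<Rightarrow> complex" where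
  "alpha_inv_deriv_root c z = c / (z + \<i>)"

lemma upper_half_plane_nonzero:
  assumes "z \<in> upper_half_plane"
  shows "z + \<i> \<noteq> 0" "\<i> + z \<noteq> 0"
  using assms by (auto simp: upper_half_plane_def complex_eq_iff)

lemma alpha_bij_betw: "bij_betw alpha (ball 0 1) upper_half_plane"
  and alpha_inv_alpha: "w \<in> ball 0 1 \<Longrightarrow> alpha_inv (alpha w) = w"
  and alpha_alpha_inv: "z \<in> upper_half_plane \<Longrightarrow> alpha (alpha_inv z) = z"
proof -
  have nz: "1 + w \<noteq> 0" if "w \<in> ball 0 1" for w :: complex
    using that by (metis add_eq_0_iff less_irrefl mem_ball_0 norm_minus_cancel norm_one)
  have im: "Im (alpha w) = (1 - (cmod w)\<^sup>2) / (cmod (1 + w))\<^sup>2" for w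
    unfolding alpha_def cmod_power2
    by (simp add: Im_divide power2_eq_square algebra_simps flip: add_divide_distrib diff_divide_distrib)
  have left: "alpha_inv (alpha w) = w" if "w \<in> ball 0 1" for w
    using nz[OF that] by (simp add: alpha_inv_def alpha_def divide_simps) (auto simp: algebra_simps)
  have right: "alpha (alpha_inv z) = z" if "z \<in> upper_half_plane" for z
  proof -
    have "1 - alpha_inv z = 2 * z / (\<i> + z)" "1 + alpha_inv z = 2 * \<i> / (\<i> + z)"
      using upper_half_plane_nonzero[OF that] by (simp_all add: alpha_inv_def divide_simps)
    then show ?thesis
      using upper_half_plane_nonzero[OF that] by (simp add: alpha_def)
  qed
  have into: "alpha w \<in> upper_half_plane" if "w \<in> ball 0 1" for w
  proof -
    have "(cmod w)\<^sup>2 < 1" using that by (simp add: power_less_one_iff abs_square_less_1)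
    then show ?thesis using nz[OF that] by (simp add: upper_half_plane_def im)
  qed
  have onto: "alpha_inv z \<in> ball 0 1" if "z \<in> upper_half_plane" for z
  proof -
    have "(cmod (\<i> - z))\<^sup>2 < (cmod (\<i> + z))\<^sup>2"
      using that unfolding cmod_power2 upper_half_plane_def by (simp add: power2_eq_square algebra_simps)
    then have "cmod (\<i> - z) < cmod (\<i> + z)" by (rule power_less_imp_less_base) simp
    then show ?thesis
      using upper_half_plane_nonzero[OF that] by (simp add: alpha_inv_def norm_divide)
  qed
  show "bij_betw alpha (ball 0 1) upper_half_plane"
    by (rule bij_betw_byWitness[where f' = alpha_inv]) (use left right into onto in auto)
  show "w \<in> ball 0 1 \<Longrightarrow> alpha_inv (alpha w) = w" by (rule left)
  show "z \<in> upper_half_plane \<Longrightarrow> alpha (alpha_inv z) = z" by (rule right)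
qed

lemma deriv_alpha_inv:
  assumes "z \<in> upper_half_plane"
  shows "deriv alpha_inv z = - 2 * \<i> / (z + \<i>)\<^sup>2"
proof (rule DERIV_imp_deriv)
  show "(alpha_inv has_field_derivative - 2 * \<i> / (z + \<i>)\<^sup>2) (at z)"
    unfolding alpha_inv_def [abs_def] using upper_half_plane_nonzero[OF assms]
    by (auto intro!: derivative_eq_intros simp: power2_eq_square divide_simps)
       (auto simp: algebra_simps)
qed

lemma alpha_inv_deriv_root_holomorphic:
  "alpha_inv_deriv_root c holomorphic_on upper_half_plane"
  unfolding alpha_inv_deriv_root_def [abs_def]
  using upper_half_plane_nonzero by (auto intro!: holomorphic_intros)

lemma alpha_inv_deriv_root_square:
  assumes "c\<^sup>2 = - 2 * \<i>" "z \<in> upper_half_plane"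
  shows "(alpha_inv_deriv_root c z)\<^sup>2 = deriv alpha_inv z"
  using assms by (simp add: alpha_inv_deriv_root_def deriv_alpha_inv power_divide)

end

theory Submission
  imports Defs "HOL-Real_Asymp.Real_Asymp"
begin

text \<open>
  Write \<open>E\<close> for the area integral of \<open>\<bar>f'\<bar>\<^sup>2\<close> over the upper half-plane. As \<open>\<bar>c\<bar>\<^sup>2 = 2\<close>, the theorem
  asks for a bound, uniform in \<open>y > 0\<close>, on
  \<open>\<integral> \<bar>f (x + i y)\<bar>\<^sup>2 / (x\<^sup>2 + (1 + y)\<^sup>2) dx\<close>. The estimate is carried out in the half-plane itself,
  with two different arguments above and below the line \<open>y = 1\<close>.

  Above the line, what counts is that \<open>f\<close> grows only logarithmically. The value of \<open>f'\<^sup>2\<close> at a point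
  \<open>z\<close> is its mean over the disc of radius \<open>Im z\<close> about \<open>z\<close>, so \<open>\<bar>f' z\<bar>\<close> is at most a constant times
  \<open>1 / Im z\<close> (\<open>dirichlet_imp_bloch\<close>). Integrating this along a path that climbs before it moves
  sideways gives \<open>\<bar>f (x + i y) - f i\<bar> \<le> C (1 + 2 ln (y + \<bar>x\<bar>))\<close> for \<open>y \<ge> 1\<close>
  (\<open>bloch_log_growth\<close>). Dividing by \<open>x\<^sup>2 + (1 + y)\<^sup>2\<close>, which is comparable to \<open>(1 + y + \<bar>x\<bar>)\<^sup>2\<close>,
  leaves the integrable majorant \<open>(1 + \<bar>x\<bar>) powr (- 3 / 2)\<close>, which is independent of \<open>y\<close>.

  Below the line, \<open>f (x + i y)\<close> is compared with \<open>f (x + i)\<close>. By Cauchy-Schwarz on the vertical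
  segment between the two points, the squared difference is at most the integral of \<open>\<bar>f'\<bar>\<^sup>2\<close> over
  that segment; integrating over \<open>x\<close> bounds the total by \<open>E\<close>, even without the weight
  (\<open>dirichlet_vertical_increment\<close>). The remaining term is the case \<open>y = 1\<close> of the first argument.

  The mean over a disc is obtained from the mean over circles by averaging over rotations, which
  needs that rotations preserve area; that follows from Fubini's theorem by writing a rotation as a
  product of three shears.
\<close>

section \<open>Area integrals over the complex plane\<close>

lemma measurable_Complex [measurable (raw)]:
  assumes "f \<in> borel_measurable M" "g \<in> borel_measurable M"
  shows "(\<lambda>x. Complex (f x) (g x)) \<in> borel_measurable M"
proof -
  have "(\<lambda>x. Complex (f x) (g x)) = (\<lambda>x. of_real (f x) + \<i> * of_real (g x))"
    by (auto simp: complex_eq_iff)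
  then show ?thesis
    using assms by simp
qed

lemma lborel_complex_eq_distr:
  "(lborel :: complex measure) = distr (lborel \<Otimes>\<^sub>M lborel) borel (\<lambda>p. Complex (fst p) (snd p))"
proof (rule lborel_eqI)
  fix l u :: complex
  assume le: "\<And>b. b \<in> Basis \<Longrightarrow> l \<bullet> b \<le> u \<bullet> b"
  have re: "Re l \<le> Re u" and im: "Im l \<le> Im u"
    using le[of 1] le[of \<i>] by (auto simp: Basis_complex_def inner_complex_def)
  have "(\<lambda>p. Complex (fst p) (snd p)) -` box l u \<inter> space (lborel \<Otimes>\<^sub>M lborel)
        = {Re l<..<Re u} \<times> {Im l<..<Im u}"
    by (auto simp: box_def Basis_complex_def inner_complex_def space_pair_measure)
  then have "emeasure (distr (lborel \<Otimes>\<^sub>M lborel) borel (\<lambda>p. Complex (fst p) (snd p))) (box l u)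
        = emeasure (lborel \<Otimes>\<^sub>M lborel) ({Re l<..<Re u} \<times> {Im l<..<Im u})"
    by (subst emeasure_distr) simp_all
  also have "\<dots> = ennreal (Re u - Re l) * ennreal (Im u - Im l)"
    using re im by (subst lborel.emeasure_pair_measure_Times) auto
  also have "\<dots> = (\<Prod>b\<in>Basis. (u - l) \<bullet> b)"
    using re im by (simp add: Basis_complex_def inner_complex_def ennreal_mult)
  finally show "emeasure (distr (lborel \<Otimes>\<^sub>M lborel) borel (\<lambda>p. Complex (fst p) (snd p))) (box l u)
     = (\<Prod>b\<in>Basis. (u - l) \<bullet> b)" .
qed simp

lemma nn_integral_complex_iterated:
  fixes F :: "complex \<Rightarrow> ennreal"
  assumes [measurable]: "F \<in> borel_measurable borel"
  shows "(\<integral>\<^sup>+z. F z \<partial>lborel) = (\<integral>\<^sup>+x. \<integral>\<^sup>+y. F (Complex x y) \<partial>lborel \<partial>lborel)"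
    and "(\<integral>\<^sup>+z. F z \<partial>lborel) = (\<integral>\<^sup>+y. \<integral>\<^sup>+x. F (Complex x y) \<partial>lborel \<partial>lborel)"
proof -
  have "(\<integral>\<^sup>+z. F z \<partial>lborel) = (\<integral>\<^sup>+p. F (Complex (fst p) (snd p)) \<partial>(lborel \<Otimes>\<^sub>M lborel))"
    by (subst lborel_complex_eq_distr, subst nn_integral_distr) auto
  also have "\<dots> = (\<integral>\<^sup>+x. \<integral>\<^sup>+y. F (Complex x y) \<partial>lborel \<partial>lborel)"
    by (subst lborel.nn_integral_fst[symmetric]) auto
  finally show *: "(\<integral>\<^sup>+z. F z \<partial>lborel) = (\<integral>\<^sup>+x. \<integral>\<^sup>+y. F (Complex x y) \<partial>lborel \<partial>lborel)" .
  also have "\<dots> = (\<integral>\<^sup>+y. \<integral>\<^sup>+x. F (Complex x y) \<partial>lborel \<partial>lborel)"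
    by (subst lborel_pair.Fubini') auto
  finally show "(\<integral>\<^sup>+z. F z \<partial>lborel) = (\<integral>\<^sup>+y. \<integral>\<^sup>+x. F (Complex x y) \<partial>lborel \<partial>lborel)" .
qed

text \<open>By Fubini, a shear acts on each line by a translation.\<close>
lemma nn_integral_horizontal_shear:
  fixes F :: "complex \<Rightarrow> ennreal"
  assumes [measurable]: "F \<in> borel_measurable borel"
  shows "(\<integral>\<^sup>+z. F (Complex (Re z + t * Im z) (Im z)) \<partial>lborel) = (\<integral>\<^sup>+z. F z \<partial>lborel)"
proof -
  have "(\<integral>\<^sup>+x. F (Complex (x + t * y) y) \<partial>lborel) = (\<integral>\<^sup>+x. F (Complex x y) \<partial>lborel)" for y
    using nn_integral_real_affine[of "\<lambda>x. F (Complex x y)" 1 "t * y"] by (simp add: add.commute)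
  then show ?thesis
    by (simp add: nn_integral_complex_iterated(2))
qed

lemma nn_integral_vertical_shear:
  fixes F :: "complex \<Rightarrow> ennreal"
  assumes [measurable]: "F \<in> borel_measurable borel"
  shows "(\<integral>\<^sup>+z. F (Complex (Re z) (Im z + t * Re z)) \<partial>lborel) = (\<integral>\<^sup>+z. F z \<partial>lborel)"
proof -
  have "(\<integral>\<^sup>+y. F (Complex x (y + t * x)) \<partial>lborel) = (\<integral>\<^sup>+y. F (Complex x y) \<partial>lborel)" for x
    using nn_integral_real_affine[of "\<lambda>y. F (Complex x y)" 1 "t * x"] by (simp add: add.commute)
  then show ?thesis
    by (simp add: nn_integral_complex_iterated(1))
qed

text \<open>A rotation by an angle \<open>\<theta>\<close> other than \<open>\<pi>\<close> is a horizontal shear by \<open>- tan (\<theta> / 2)\<close>, a vertical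
  shear by \<open>sin \<theta>\<close> and the first shear again. The half-turn has no such factorisation, but it is
  two quarter-turns.\<close>
lemma nn_integral_rotation:
  fixes F :: "complex \<Rightarrow> ennreal"
  assumes [measurable]: "F \<in> borel_measurable borel" and c: "cmod c = 1"
  shows "(\<integral>\<^sup>+z. F (c * z) \<partial>lborel) = (\<integral>\<^sup>+z. F z \<partial>lborel)"
proof -
  have rot: "(\<integral>\<^sup>+z. G (c * z) \<partial>lborel) = (\<integral>\<^sup>+z. G z \<partial>lborel)"
    if [measurable]: "G \<in> borel_measurable borel" and c: "cmod c = 1" "c \<noteq> -1" 
    for G :: "complex \<Rightarrow> ennreal" and c :: complex
  proof -
    define p q where "p = Re c" and "q = Im c"
    \<comment> \<open>With \<open>c = cis \<theta>\<close> this is \<open>- tan (\<theta> / 2)\<close>, defined because \<open>c \<noteq> - 1\<close>.\<close>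
    define t where "t = - q / (1 + p)"
    have pq: "p\<^sup>2 + q\<^sup>2 = 1"
      using c(1) cmod_power2[of c] by (simp add: p_def q_def)
    have p: "1 + p \<noteq> 0"
    proof
      assume "1 + p = 0"
      then have "p = -1" by simp
      moreover from this have "q = 0" using pq by simp
      ultimately show False using c(2) by (auto simp: p_def q_def complex_eq_iff)
    qed
    have tp: "t * (1 + p) = - q" using p by (simp add: t_def)
    have "(t * q) * (1 + p) = - (q * q)"
      using tp by (metis mult.commute mult.left_commute mult_minus_right)
    also have "\<dots> = (p - 1) * (1 + p)"
      using pq by (simp add: power2_eq_square algebra_simps)
    finally have "(t * q) * (1 + p) = (p - 1) * (1 + p)" .
    then have tq: "t * q = p - 1" using p by simp
    have eq: "c * z = (let u = Re z + t * Im z; v = Im z + q * u in Complex (u + t * v) v)" for z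
    proof -
      have "Im z + q * (Re z + t * Im z) = q * Re z + (1 + t * q) * Im z"
        by (simp add: algebra_simps)
      then have v: "Im z + q * (Re z + t * Im z) = q * Re z + p * Im z"
        by (simp add: tq)
      have "Re z + t * Im z + t * (q * Re z + p * Im z) 
          = (1 + t * q) * Re z + (t * (1 + p)) * Im z"
        by (simp add: algebra_simps)
      then have "Re z + t * Im z + t * (q * Re z + p * Im z) = p * Re z - q * Im z"
        by (simp add: tq tp)
      then show ?thesis
        unfolding Let_def v by (simp add: complex_eq_iff flip: p_def q_def)
    qed
    define H where "H z = G (Complex (Re z + t * Im z) (Im z))" for z
    define K where "K z = H (Complex (Re z) (Im z + q * Re z))" for z
    have [measurable]: "H \<in> borel_measurable borel" "K \<in> borel_measurable borel"
      unfolding H_def[abs_def] K_def[abs_def] by measurable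
    have "(\<integral>\<^sup>+z. G (c * z) \<partial>lborel) = (\<integral>\<^sup>+z. K (Complex (Re z + t * Im z) (Im z)) \<partial>lborel)"
      by (simp add: eq Let_def H_def K_def)
    also have "\<dots> = (\<integral>\<^sup>+z. K z \<partial>lborel)"
      by (rule nn_integral_horizontal_shear) simp
    also have "\<dots> = (\<integral>\<^sup>+z. H z \<partial>lborel)"
      unfolding K_def by (rule nn_integral_vertical_shear) simp
    also have "\<dots> = (\<integral>\<^sup>+z. G z \<partial>lborel)"
      unfolding H_def by (rule nn_integral_horizontal_shear) simp
    finally show ?thesis .
  qed
  show ?thesis
  proof (cases "c = -1")
    case True
    have "(\<integral>\<^sup>+z. F (c * z) \<partial>lborel) = (\<integral>\<^sup>+z. F (\<i> * (\<i> * z)) \<partial>lborel)"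
      by (simp add: True flip: mult.assoc)
    also have "\<dots> = (\<integral>\<^sup>+z. F (\<i> * z) \<partial>lborel)"
      by (rule rot[of "\<lambda>z. F (\<i> * z)"]) (auto simp: complex_eq_iff)
    also have "\<dots> = (\<integral>\<^sup>+z. F z \<partial>lborel)"
      by (rule rot) (auto simp: complex_eq_iff)
    finally show ?thesis .
  qed (use c rot in auto)
qed

section \<open>Pointwise bounds from area integrals\<close>

text \<open>Cauchy's formula applied to \<open>h\<^sup>2\<close>, whose absolute value is the square of that of \<open>h\<close>.\<close>
lemma holomorphic_square_le_circle_mean:
  fixes h :: "complex \<Rightarrow> complex"
  assumes "h holomorphic_on cball 0 1"
  shows "ennreal ((cmod (h 0))\<^sup>2)
    \<le> (\<integral>\<^sup>+t. ennreal ((cmod (h (exp (2 * of_real pi * \<i> * of_real t))))\<^sup>2) * indicator {0..1} t \<partial>lborel)"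
proof -
  define e where "e t = exp (2 * of_real pi * \<i> * of_real t)" for t
  have en: "cmod (e t) = 1" for t by (simp add: e_def norm_exp_eq_Re)
  have "((\<lambda>u. (h u)\<^sup>2 / (u - 0)) has_contour_integral (2 * of_real pi * \<i> * (h 0)\<^sup>2)) (circlepath 0 1)"
    using assms by (intro Cauchy_integral_circlepath_simple holomorphic_intros) auto
  moreover have "circlepath 0 1 t = e t" for t
    by (simp add: circlepath e_def)
  moreover have "vector_derivative (circlepath 0 1) (at t within {0..1}) = 2 * of_real pi * \<i> * e t"
    if "t \<in> {0..1}" for t
    using that by (subst vector_derivative_circlepath01) (auto simp: e_def)
  ultimately have "((\<lambda>t. (h (e t))\<^sup>2 / e t * (2 * of_real pi * \<i> * e t)) 
      has_integral (2 * of_real pi * \<i> * (h 0)\<^sup>2)) {0..1}"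
    unfolding has_contour_integral_def by (elim has_integral_eq[rotated]) simp
  then have "((\<lambda>t. (2 * of_real pi * \<i>) * (h (e t))\<^sup>2) has_integral (2 * of_real pi * \<i> * (h 0)\<^sup>2)) {0..1}"
    by (simp add: mult.commute e_def)
  from has_integral_mult_right[OF this, of "1 / (2 * of_real pi * \<i>)"]
  have I: "((\<lambda>t. (h (e t))\<^sup>2) has_integral (h 0)\<^sup>2) {0..1}"
    by simp
  have cont: "continuous_on {0..1} (\<lambda>t. h (e t))"
  proof (rule continuous_on_compose2[OF holomorphic_on_imp_continuous_on[OF assms]])
    show "continuous_on {0..1} e" unfolding e_def[abs_def] by (intro continuous_intros)
  qed (auto simp: en)
  then have int: "(\<lambda>t. (cmod (h (e t)))\<^sup>2) integrable_on {0..1}"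
    by (intro integrable_continuous_interval continuous_intros)
  have "cmod ((h 0)\<^sup>2) = cmod (integral {0..1} (\<lambda>t. (h (e t))\<^sup>2))"
    using I by (simp add: integral_unique)
  also have "\<dots> \<le> integral {0..1} (\<lambda>t. (cmod (h (e t)))\<^sup>2)"
    using I int by (intro integral_norm_bound_integral) (auto simp: norm_power)
  finally have "ennreal ((cmod (h 0))\<^sup>2) \<le> ennreal (integral {0..1} (\<lambda>t. (cmod (h (e t)))\<^sup>2))"
    by (simp add: norm_power ennreal_leI)
  also have "\<dots> = (\<integral>\<^sup>+t. ennreal ((cmod (h (e t)))\<^sup>2) * indicator {0..1} t \<partial>lborel)"
    using int by (intro nn_integral_has_integral_lebesgue'[symmetric]) (auto simp: integrable_integral)
  finally show ?thesis
    unfolding e_def .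
qed

text \<open>For each \<open>w\<close> in the disc about 0, the circle mean of the function that takes \<open>\<zeta>\<close> to
  \<open>g (z + \<zeta> w)\<close> bounds \<open>\<bar>g z\<bar>\<^sup>2\<close>. After integration over \<open>w\<close> and an exchange of the integrals,
  rotation invariance makes the inner integral independent of the angle.\<close>
lemma holomorphic_square_le_area_mean:
  fixes g :: "complex \<Rightarrow> complex"
  assumes g: "g holomorphic_on ball z R" and R: "R > 0"
  shows "ennreal (pi * R\<^sup>2 * (cmod (g z))\<^sup>2) \<le> (\<integral>\<^sup>+w\<in>ball z R. ennreal ((cmod (g w))\<^sup>2) \<partial>lborel)"
proof -
  define e where "e t = exp (2 * of_real pi * \<i> * of_real t)" for t
  have en: "cmod (e t) = 1" for t by (simp add: e_def)
  have [measurable]: "e \<in> borel_measurable borel"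
    unfolding e_def[abs_def] by (intro borel_measurable_continuous_onI continuous_intros)
  define G where "G w = ennreal ((cmod (g w))\<^sup>2) * indicator (ball z R) w" for w
  have [measurable]: "(\<lambda>w. indicator (ball z R) w *\<^sub>R g w) \<in> borel_measurable borel"
    using g by (intro borel_measurable_continuous_on_indicator holomorphic_on_imp_continuous_on) auto
  have G_eq: "G = (\<lambda>w. ennreal ((cmod (indicator (ball z R) w *\<^sub>R g w))\<^sup>2))"
    by (auto simp: G_def indicator_def)
  have [measurable]: "G \<in> borel_measurable borel"
    unfolding G_eq by measurable
  have point: "ennreal ((cmod (g z))\<^sup>2) * indicator (ball 0 R) w
      \<le> (\<integral>\<^sup>+t. G (z + e t * w) * indicator {0..1} t \<partial>lborel)" for w
  proof (cases "w \<in> ball 0 R")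
    case True
    have inb: "z + \<zeta> * w \<in> ball z R" if "cmod \<zeta> \<le> 1" for \<zeta>
    proof -
      have "cmod (\<zeta> * w) \<le> 1 * cmod w"
        unfolding norm_mult using that by (intro mult_right_mono) auto
      then show ?thesis using True by (simp add: dist_norm)
    qed
    have "(\<lambda>\<zeta>. g (z + \<zeta> * w)) holomorphic_on cball 0 1"
      by (rule holomorphic_on_compose_gen[OF _ g, unfolded o_def])
         (auto intro!: holomorphic_intros inb)
    from holomorphic_square_le_circle_mean[OF this]
    have "ennreal ((cmod (g z))\<^sup>2)
        \<le> (\<integral>\<^sup>+t. ennreal ((cmod (g (z + e t * w)))\<^sup>2) * indicator {0..1} t \<partial>lborel)"
      by (simp add: e_def)
    also have "\<dots> = (\<integral>\<^sup>+t. G (z + e t * w) * indicator {0..1} t \<partial>lborel)"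
      using inb en by (intro nn_integral_cong) (simp add: G_def)
    finally show ?thesis using True by simp
  qed simp
  have "ennreal (pi * R\<^sup>2 * (cmod (g z))\<^sup>2) = ennreal ((cmod (g z))\<^sup>2) * emeasure lborel (ball (0::complex) R)"
    using R by (simp add: emeasure_ball unit_ball_vol_2 ennreal_mult mult.commute)
  also have "\<dots> = (\<integral>\<^sup>+w. ennreal ((cmod (g z))\<^sup>2) * indicator (ball 0 R) w \<partial>(lborel :: complex measure))"
    by (simp add: nn_integral_cmult_indicator)
  also have "\<dots> \<le> (\<integral>\<^sup>+w. \<integral>\<^sup>+t. G (z + e t * w) * indicator {0..1} t \<partial>lborel \<partial>lborel)"
    by (intro nn_integral_mono point)
  also have "\<dots> = (\<integral>\<^sup>+t. \<integral>\<^sup>+w. G (z + e t * w) * indicator {0..1} t \<partial>lborel \<partial>lborel)"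
    by (rule lborel_pair.Fubini') measurable
  also have "\<dots> = (\<integral>\<^sup>+t. (\<integral>\<^sup>+w. G (z + e t * w) \<partial>lborel) * indicator {0..1} t \<partial>lborel)"
    by (intro nn_integral_cong nn_integral_multc) measurable
  also have "\<dots> = (\<integral>\<^sup>+t. (\<integral>\<^sup>+w. G (z + w) \<partial>lborel) * indicator {0..1::real} t \<partial>lborel)"
    using en by (intro nn_integral_cong arg_cong2[where f = "(*)"] nn_integral_rotation[of "\<lambda>w. G (z + w)"]) auto
  also have "\<dots> = (\<integral>\<^sup>+w. G (z + w) \<partial>lborel)"
    by (subst nn_integral_cmult_indicator) auto
  also have "\<dots> = (\<integral>\<^sup>+w. G w \<partial>distr lborel borel ((+) z))"
    by (subst nn_integral_distr) auto
  also have "\<dots> = (\<integral>\<^sup>+w. G w \<partial>lborel)"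
    by (simp add: lborel_distr_plus)
  finally show ?thesis
    by (simp add: G_def)
qed

section \<open>Growth of Dirichlet functions\<close>

text \<open>The fundamental theorem of calculus followed by Cauchy-Schwarz against the constant 1.\<close>
lemma C1_increment_square_le:
  fixes \<phi> \<phi>' :: "real \<Rightarrow> 'a::euclidean_space"
  assumes "a \<le> b"
    and deriv: "\<And>t. t \<in> {a..b} \<Longrightarrow> (\<phi> has_vector_derivative \<phi>' t) (at t within {a..b})"
    and cont: "continuous_on {a..b} \<phi>'"
  shows "ennreal ((norm (\<phi> b - \<phi> a))\<^sup>2)
    \<le> ennreal (b - a) * (\<integral>\<^sup>+t\<in>{a..b}. ennreal ((norm (\<phi>' t))\<^sup>2) \<partial>lborel)"
proof -
  define u where "u t = ennreal (norm (\<phi>' t)) * indicator {a..b} t" for t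
  have [measurable]: "(\<lambda>t. indicator {a..b} t *\<^sub>R \<phi>' t) \<in> borel_measurable borel"
    using cont by (intro borel_measurable_continuous_on_indicator) auto
  have u_eq: "u = (\<lambda>t. ennreal (norm (indicator {a..b} t *\<^sub>R \<phi>' t)))"
    by (auto simp: u_def indicator_def)
  have [measurable]: "u \<in> borel_measurable borel"
    unfolding u_eq by measurable
  have I: "(\<phi>' has_integral (\<phi> b - \<phi> a)) {a..b}"
    using assms by (intro fundamental_theorem_of_calculus) auto
  have int: "(\<lambda>t. norm (\<phi>' t)) integrable_on {a..b}"
    using cont by (intro integrable_continuous_interval continuous_intros)
  have "norm (\<phi> b - \<phi> a) \<le> integral {a..b} (\<lambda>t. norm (\<phi>' t))"
    using I int by (metis integral_norm_bound_integral integral_unique has_integral_integrable order_refl)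
  then have "ennreal (norm (\<phi> b - \<phi> a)) \<le> ennreal (integral {a..b} (\<lambda>t. norm (\<phi>' t)))"
    by (rule ennreal_leI)
  also have "\<dots> = (\<integral>\<^sup>+t. u t \<partial>lborel)"
    unfolding u_def using int
    by (intro nn_integral_has_integral_lebesgue'[symmetric]) (auto simp: integrable_integral)
  also have "\<dots> = (\<integral>\<^sup>+t. indicator {a..b} t * u t \<partial>lborel)"
    by (intro nn_integral_cong) (auto simp: u_def indicator_def)
  finally have "(ennreal (norm (\<phi> b - \<phi> a)))\<^sup>2 \<le> (\<integral>\<^sup>+t. indicator {a..b} t * u t \<partial>lborel)\<^sup>2"
    by (intro power_mono) auto
  also have "\<dots> \<le> (\<integral>\<^sup>+t. (indicator {a..b} t)\<^sup>2 \<partial>lborel) * (\<integral>\<^sup>+t. (u t)\<^sup>2 \<partial>lborel)"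
    by (rule Cauchy_Schwarz_nn_integral) auto
  also have "(\<integral>\<^sup>+t. (indicator {a..b} t)\<^sup>2 \<partial>lborel) = (\<integral>\<^sup>+t. indicator {a..b} t \<partial>lborel)"
    by (intro nn_integral_cong) (auto simp: indicator_def)
  also have "\<dots> = ennreal (b - a)"
    using \<open>a \<le> b\<close> by simp
  also have "(\<integral>\<^sup>+t. (u t)\<^sup>2 \<partial>lborel) = (\<integral>\<^sup>+t\<in>{a..b}. ennreal ((norm (\<phi>' t))\<^sup>2) \<partial>lborel)"
    by (intro nn_integral_cong) (auto simp: u_def indicator_def ennreal_power)
  finally show ?thesis
    by (simp add: ennreal_power)
qed

lemma open_upper_half_plane: "open upper_half_plane"
  unfolding upper_half_plane_def by (rule open_halfspace_Im_gt)

lemma Complex_in_upper_half_plane [simp]: "Complex x y \<in> upper_half_plane \<longleftrightarrow> y > 0"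
  by (simp add: upper_half_plane_def)

lemma has_vector_derivative_vertical:
  assumes "f holomorphic_on upper_half_plane" "t > 0"
  shows "((\<lambda>t. f (Complex x t)) has_vector_derivative \<i> * deriv f (Complex x t)) (at t within S)"
proof -
  have "(f has_field_derivative deriv f (Complex x t)) (at (Complex x t))"
    using assms by (intro holomorphic_derivI[OF _ open_upper_half_plane]) auto
  moreover have "((\<lambda>t. Complex x t) has_vector_derivative \<i>) (at t within S)"
    unfolding Complex_eq by (auto intro!: derivative_eq_intros)
  ultimately have "((f \<circ> Complex x) has_vector_derivative \<i> * deriv f (Complex x t)) (at t within S)"
    by (intro field_vector_diff_chain_within) (auto intro: has_field_derivative_at_within)
  then show ?thesis
    by (simp add: o_def)
qed

lemma continuous_on_deriv_vertical:
  assumes "f holomorphic_on upper_half_plane" "S \<subseteq> {0<..}"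
  shows "continuous_on S (\<lambda>t. \<i> * deriv f (Complex x t))"
proof (intro continuous_intros)
  have "continuous_on upper_half_plane (deriv f)"
    using assms open_upper_half_plane by (intro holomorphic_on_imp_continuous_on holomorphic_deriv)
  then show "continuous_on S (\<lambda>t. deriv f (Complex x t))"
    by (rule continuous_on_compose2) (use assms(2) in \<open>auto simp: Complex_eq upper_half_plane_def intro!: continuous_intros\<close>)
qed

text \<open>The disc of radius \<open>Im z\<close> about \<open>z\<close> is the largest one in the half-plane, and the mean value
  estimate on it bounds \<open>pi (Im z)\<^sup>2 \<bar>f' z\<bar>\<^sup>2\<close> by the Dirichlet integral of \<open>f\<close>. Functions with such
  a derivative bound are the Bloch functions of the half-plane.\<close>
lemma dirichlet_imp_bloch:
  assumes "f \<in> dirichlet_space"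
  obtains C where "C \<ge> 0" "\<And>z. z \<in> upper_half_plane \<Longrightarrow> cmod (deriv f z) \<le> C / Im z"
proof -
  define E where "E = enn2real (\<integral>\<^sup>+ z \<in> upper_half_plane. ennreal ((cmod (deriv f z))\<^sup>2) \<partial>lborel)"
  have hol: "deriv f holomorphic_on upper_half_plane"
    and E: "(\<integral>\<^sup>+ z \<in> upper_half_plane. ennreal ((cmod (deriv f z))\<^sup>2) \<partial>lborel) = ennreal E"
    using assms open_upper_half_plane by (auto simp: dirichlet_space_def E_def intro!: holomorphic_deriv)
  have E0: "E \<ge> 0" by (simp add: E_def)
  show ?thesis
  proof (rule that[of "sqrt (E / pi)"])
    fix z assume z: "z \<in> upper_half_plane"
    then have pos: "Im z > 0" by (simp add: upper_half_plane_def)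
    have sub: "ball z (Im z) \<subseteq> upper_half_plane"
    proof
      fix w assume "w \<in> ball z (Im z)"
      then have "\<bar>Im (z - w)\<bar> < Im z"
        using abs_Im_le_cmod[of "z - w"] by (simp add: dist_norm)
      then show "w \<in> upper_half_plane" by (simp add: upper_half_plane_def)
    qed
    have "ennreal (pi * (Im z)\<^sup>2 * (cmod (deriv f z))\<^sup>2)
        \<le> (\<integral>\<^sup>+w\<in>ball z (Im z). ennreal ((cmod (deriv f w))\<^sup>2) \<partial>lborel)"
      using pos sub hol by (intro holomorphic_square_le_area_mean) (auto intro: holomorphic_on_subset)
    also have "\<dots> \<le> ennreal E"
      unfolding E[symmetric] using sub
      by (intro nn_integral_mono mult_left_mono) (auto simp: indicator_def)
    finally have "(Im z * cmod (deriv f z))\<^sup>2 \<le> E / pi"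
      using E0 by (simp add: power_mult_distrib field_simps)
    then have "Im z * cmod (deriv f z) \<le> sqrt (E / pi)"
      by (rule real_le_rsqrt)
    then show "cmod (deriv f z) \<le> sqrt (E / pi) / Im z"
      using pos by (simp add: field_simps)
  qed (use E0 in simp)
qed

text \<open>The path from \<open>i\<close> to \<open>x + i y\<close> goes up the imaginary axis to height \<open>r = y + \<bar>x\<bar>\<close>, across and
  down again. The vertical parts cost at most \<open>C ln r\<close> each, and the horizontal part, of
  length \<open>\<bar>x\<bar> \<le> r\<close> at height \<open>r\<close>, costs at most \<open>C\<close>. Moving sideways at a lower height would only
  give linear growth in \<open>\<bar>x\<bar>\<close>.\<close>
lemma bloch_log_growth:
  assumes f: "f holomorphic_on upper_half_plane"
    and C: "C \<ge> 0" "\<And>z. z \<in> upper_half_plane \<Longrightarrow> cmod (deriv f z) \<le> C / Im z"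
    and y: "y \<ge> 1"
  shows "cmod (f (Complex x y) - f \<i>) \<le> C * (1 + 2 * ln (y + \<bar>x\<bar>))"
proof -
  have vert: "cmod (f (Complex x b) - f (Complex x a)) \<le> C * ln b - C * ln a"
    if ab: "0 < a" "a \<le> b" for x a b
  proof (cases "a = b")
    case False
    have "continuous_on {a..b} (\<lambda>t. f (Complex x t))"
      by (rule continuous_on_vector_derivative, rule has_vector_derivative_vertical[OF f])
         (use ab in auto)
    moreover have "continuous_on {a..b} (\<lambda>t. C * ln t)"
      using ab by (intro continuous_intros) auto
    ultimately show ?thesis
    proof (rule differentiable_bound_general[rotated])
      fix t assume t: "a < t" "t < b"
      show "((\<lambda>t. f (Complex x t)) has_vector_derivative \<i> * deriv f (Complex x t)) (at t)"
        using t ab by (intro has_vector_derivative_vertical[OF f]) auto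
      show "((\<lambda>t. C * ln t) has_vector_derivative C / t) (at t)"
        using t ab by (auto simp flip: has_real_derivative_iff_has_vector_derivative
            intro!: derivative_eq_intros)
      show "cmod (\<i> * deriv f (Complex x t)) \<le> C / t"
        using C(2)[of "Complex x t"] t ab by (simp add: norm_mult)
    qed (use ab False in auto)
  qed simp
  define r where "r = y + \<bar>x\<bar>"
  have r: "r \<ge> 1" "y \<le> r" "\<bar>x\<bar> \<le> r" using y by (auto simp: r_def)
  have horiz: "cmod (f (Complex x r) - f (Complex 0 r)) \<le> C / r * cmod (Complex x r - Complex 0 r)"
  proof (rule field_differentiable_bound)
    show "convex {z. Im z = r}"
      using convex_hyperplane[of \<i> r] by (simp add: inner_complex_def)
    fix z assume "z \<in> {z. Im z = r}"
    then have z: "z \<in> upper_half_plane" "Im z = r"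
      using r by (auto simp: upper_half_plane_def)
    show "(f has_field_derivative deriv f z) (at z within {z. Im z = r})"
      using z by (intro holomorphic_derivI[OF f open_upper_half_plane])
    show "cmod (deriv f z) \<le> C / r"
      using C(2)[OF z(1)] z(2) by simp
  qed auto
  have "C / r * cmod (Complex x r - Complex 0 r) = C * (\<bar>x\<bar> / r)"
    by (simp add: cmod_def)
  also have "\<dots> \<le> C * 1"
    using r C(1) by (intro mult_left_mono) auto
  finally have "cmod (f (Complex x r) - f (Complex 0 r)) \<le> C"
    using horiz by simp
  moreover have "cmod (f (Complex x r) - f (Complex x y)) \<le> C * ln r"
  proof -
    have "0 \<le> C * ln y" using C(1) y by simp
    then show ?thesis using vert[of y r x] y r by simp
  qed
  moreover have "cmod (f (Complex 0 r) - f \<i>) \<le> C * ln r"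
    using vert[of 1 r 0] r by (simp flip: imaginary_unit.code)
  moreover have "f (Complex x y) - f \<i> = (f (Complex x r) - f (Complex 0 r))
      - (f (Complex x r) - f (Complex x y)) + (f (Complex 0 r) - f \<i>)"
    by simp
  then have "cmod (f (Complex x y) - f \<i>) \<le> cmod (f (Complex x r) - f (Complex 0 r))
      + cmod (f (Complex x r) - f (Complex x y)) + cmod (f (Complex 0 r) - f \<i>)"
    by (metis norm_triangle_ineq norm_triangle_ineq4 add_right_mono order_trans)
  ultimately show ?thesis
    by (simp add: r_def algebra_simps)
qed

section \<open>Integrals over horizontal lines\<close>

text \<open>With \<open>r = y + \<bar>x\<bar>\<close>, the logarithm is absorbed in \<open>r powr (1 / 4)\<close>, so that \<open>u\<^sup>2\<close> is of order
  \<open>sqrt r\<close> while the denominator is of order \<open>(1 + r)\<^sup>2\<close>. The resulting decay of order \<open>3 / 2\<close> is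
  integrable in \<open>x\<close>, and the bound no longer involves \<open>y\<close>.\<close>
lemma log_growth_square_le:
  assumes y: "y \<ge> 1" and M: "M \<ge> 0" and C: "C \<ge> 0"
    and u: "u \<ge> 0" "u \<le> M + C * (1 + 2 * ln (y + \<bar>x\<bar>))"
  shows "u\<^sup>2 / (x\<^sup>2 + (1 + y)\<^sup>2) \<le> 2 * (M + 9 * C)\<^sup>2 * (1 / ((1 + \<bar>x\<bar>) * sqrt (1 + \<bar>x\<bar>)))"
proof -
  define r s where "r = y + \<bar>x\<bar>" and "s = sqrt (sqrt r)"
  have r: "r \<ge> 1" "\<bar>x\<bar> \<le> r" using y by (auto simp: r_def)
  have s: "s \<ge> 1" "s\<^sup>2 = sqrt r" using r by (simp_all add: s_def)
  have "s ^ 4 = (s\<^sup>2)\<^sup>2" by simp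
  then have s4: "s ^ 4 = r" using r by (simp add: s(2))
  have "ln r = 4 * ln s" unfolding s4[symmetric] using s by (simp add: ln_realpow)
  also have "\<dots> \<le> 4 * s" using s ln_le_minus_one[of s] by simp
  finally have ln_le: "ln r \<le> 4 * s" .
  have "u \<le> M + C * (1 + 2 * ln r)" using u by (simp add: r_def)
  also have "\<dots> \<le> M * s + C * (s + 8 * s)"
    using M C s ln_le by (intro add_mono mult_left_mono) (auto simp: mult_le_cancel_left1)
  also have "\<dots> = (M + 9 * C) * s" by (simp add: algebra_simps)
  finally have "u\<^sup>2 \<le> ((M + 9 * C) * s)\<^sup>2" using u by (intro power_mono)
  then have u2: "u\<^sup>2 \<le> (M + 9 * C)\<^sup>2 * sqrt r" by (simp add: power_mult_distrib s)
  have "0 \<le> (\<bar>x\<bar> - (1 + y))\<^sup>2" by simp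
  then have den: "(1 + r)\<^sup>2 / 2 \<le> x\<^sup>2 + (1 + y)\<^sup>2"
    by (simp add: r_def power2_eq_square algebra_simps)
  have "u\<^sup>2 / (x\<^sup>2 + (1 + y)\<^sup>2) \<le> ((M + 9 * C)\<^sup>2 * sqrt r) / ((1 + r)\<^sup>2 / 2)"
    using u2 den r by (intro frac_le) auto
  also have "\<dots> = 2 * (M + 9 * C)\<^sup>2 * (sqrt r / (1 + r)\<^sup>2)" by simp
  also have "sqrt r / (1 + r)\<^sup>2 \<le> sqrt (1 + r) / (1 + r)\<^sup>2"
    using r by (intro divide_right_mono) auto
  also have "sqrt (1 + r) / (1 + r)\<^sup>2 = 1 / ((1 + r) * sqrt (1 + r))"
  proof -
    have "q / (q * q)\<^sup>2 = 1 / (q * q * q)" if "q > 0" for q :: real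
      using that by (simp add: field_simps power2_eq_square)
    from this[of "sqrt (1 + r)"] show ?thesis
      using r by simp
  qed
  also have "\<dots> \<le> 1 / ((1 + \<bar>x\<bar>) * sqrt (1 + \<bar>x\<bar>))"
    using r by (intro divide_left_mono mult_mono mult_pos_pos) auto
  finally show ?thesis by (simp add: mult_left_mono)
qed

lemma nn_integral_three_halves_decay:
  "(\<integral>\<^sup>+x. ennreal (1 / ((1 + \<bar>x\<bar>) * sqrt (1 + \<bar>x\<bar>))) \<partial>(lborel :: real measure)) \<le> 4"
proof -
  define w where "w x = 1 / ((1 + \<bar>x\<bar>) * sqrt (1 + \<bar>x\<bar>))" for x :: real
  have [measurable]: "w \<in> borel_measurable borel" unfolding w_def[abs_def] by measurable
  have half: "(\<integral>\<^sup>+x. ennreal (w x) * indicator {0..} x \<partial>lborel) = 2"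
  proof -
    have "(\<integral>\<^sup>+x. ennreal (w x) * indicator {0..} x \<partial>lborel) = ennreal (0 - (- 2 / sqrt (1 + 0)))"
    proof (rule nn_integral_FTC_atLeast)
      show "DERIV (\<lambda>x. - 2 / sqrt (1 + x)) x :> w x" if "0 \<le> x" for x
        using that by (auto intro!: derivative_eq_intros simp: w_def field_simps)
      show "((\<lambda>x. - 2 / sqrt (1 + x)) \<longlongrightarrow> 0) at_top"
        by real_asymp
    qed (auto simp: w_def)
    then show ?thesis by simp
  qed
  have "(\<integral>\<^sup>+x. ennreal (w x) \<partial>lborel)
      \<le> (\<integral>\<^sup>+x. ennreal (w x) * indicator {0..} x + ennreal (w (-x)) * indicator {0..} (-x) \<partial>lborel)"
    by (intro nn_integral_mono) (auto simp: indicator_def w_def)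
  also have "\<dots> = (\<integral>\<^sup>+x. ennreal (w x) * indicator {0..} x \<partial>lborel)
      + (\<integral>\<^sup>+x. ennreal (w (-x)) * indicator {0..} (-x) \<partial>lborel)"
    by (intro nn_integral_add) auto
  also have "(\<integral>\<^sup>+x. ennreal (w (-x)) * indicator {0..} (-x) \<partial>lborel)
      = (\<integral>\<^sup>+x. ennreal (w x) * indicator {0..} x \<partial>lborel)"
    using nn_integral_real_affine[of "\<lambda>x. ennreal (w x) * indicator {0..} x" "-1" 0] by simp
  finally show ?thesis
    unfolding half by (simp add: w_def)
qed

text \<open>Each vertical segment has length at most 1 and the segments sweep out part of the half-plane, so
  Fubini turns the one-dimensional estimate into the Dirichlet integral.\<close>
lemma dirichlet_vertical_increment:
  assumes f: "f holomorphic_on upper_half_plane" and y: "0 < y" "y \<le> 1"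
  shows "(\<integral>\<^sup>+x. ennreal ((cmod (f (Complex x y) - f (Complex x 1)))\<^sup>2) \<partial>lborel)
    \<le> (\<integral>\<^sup>+z\<in>upper_half_plane. ennreal ((cmod (deriv f z))\<^sup>2) \<partial>lborel)"
proof -
  define G where "G z = ennreal ((cmod (deriv f z))\<^sup>2) * indicator upper_half_plane z" for z
  have [measurable]: "(\<lambda>z. indicator upper_half_plane z *\<^sub>R deriv f z) \<in> borel_measurable borel"
    using f open_upper_half_plane
    by (intro borel_measurable_continuous_on_indicator holomorphic_on_imp_continuous_on
        holomorphic_deriv) auto
  have G_eq: "G = (\<lambda>z. ennreal ((cmod (indicator upper_half_plane z *\<^sub>R deriv f z))\<^sup>2))"
    by (auto simp: G_def indicator_def)
  have [measurable]: "G \<in> borel_measurable borel"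
    unfolding G_eq by measurable
  have line: "ennreal ((cmod (f (Complex x y) - f (Complex x 1)))\<^sup>2)
      \<le> (\<integral>\<^sup>+t. G (Complex x t) \<partial>lborel)" for x
  proof -
    have "ennreal ((cmod (f (Complex x 1) - f (Complex x y)))\<^sup>2)
        \<le> ennreal (1 - y) * (\<integral>\<^sup>+t\<in>{y..1}. ennreal ((cmod (\<i> * deriv f (Complex x t)))\<^sup>2) \<partial>lborel)"
      using y f by (intro C1_increment_square_le has_vector_derivative_vertical
          continuous_on_deriv_vertical) auto
    also have "\<dots> \<le> 1 * (\<integral>\<^sup>+t\<in>{y..1}. ennreal ((cmod (\<i> * deriv f (Complex x t)))\<^sup>2) \<partial>lborel)"
      using y by (intro mult_right_mono) auto
    also have "\<dots> \<le> (\<integral>\<^sup>+t. G (Complex x t) \<partial>lborel)"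
      unfolding mult_1 using y
      by (intro nn_integral_mono) (auto simp: G_def indicator_def norm_mult)
    finally show ?thesis by (simp add: norm_minus_commute)
  qed
  have "(\<integral>\<^sup>+x. ennreal ((cmod (f (Complex x y) - f (Complex x 1)))\<^sup>2) \<partial>lborel)
    \<le> (\<integral>\<^sup>+x. \<integral>\<^sup>+t. G (Complex x t) \<partial>lborel \<partial>lborel)"
    by (intro nn_integral_mono line)
  also have "\<dots> = (\<integral>\<^sup>+z. G z \<partial>lborel)"
    by (simp add: nn_integral_complex_iterated(1))
  finally show ?thesis by (simp add: G_def)
qed

lemma hardy_norm_finiteI:
  assumes B: "B \<ge> 0"
    and bound: "\<And>y. y > 0 \<Longrightarrow> (\<integral>\<^sup>+x. ennreal ((cmod (f (Complex x y)))\<^sup>2) \<partial>lborel) \<le> ennreal B"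
  shows "hardy_norm f < \<infinity>"
proof -
  have "ennreal_sqrt a \<le> ennreal (sqrt B)" if "a \<le> ennreal B" for a
  proof -
    have "a < \<infinity>" using that by (simp add: le_less_trans[OF _ ennreal_less_top])
    then have "enn2real a \<le> B" "a \<noteq> \<infinity>"
      using that B enn2real_mono[OF that] by auto
    then show ?thesis by (simp add: ennreal_sqrt_def ennreal_leI)
  qed
  then have "hardy_norm f \<le> ennreal (sqrt B)"
    unfolding hardy_norm_def using bound by (intro SUP_least) auto
  also have "\<dots> < \<infinity>" by simp
  finally show ?thesis .
qed

theorem theorem5p1:
  fixes f :: "complex \<Rightarrow> complex" and c :: complex
  assumes "c\<^sup>2 = - 2 * \<i>"
    and "f \<in> dirichlet_space"
  shows "(\<lambda>z. f z * alpha_inv_deriv_root c z) \<in> hardy_space"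
proof -
  have hol: "f holomorphic_on upper_half_plane"
    using assms(2) by (simp add: dirichlet_space_def)
  define E where "E = enn2real (\<integral>\<^sup>+z\<in>upper_half_plane. ennreal ((cmod (deriv f z))\<^sup>2) \<partial>lborel)"
  have E: "(\<integral>\<^sup>+z\<in>upper_half_plane. ennreal ((cmod (deriv f z))\<^sup>2) \<partial>lborel) = ennreal E" "E \<ge> 0"
    using assms(2) by (auto simp: dirichlet_space_def E_def)
  obtain C where C: "C \<ge> 0" "\<And>z. z \<in> upper_half_plane \<Longrightarrow> cmod (deriv f z) \<le> C / Im z"
    using dirichlet_imp_bloch[OF assms(2)] by blast
  define K where "K = 2 * (cmod (f \<i>) + 9 * C)\<^sup>2"
  define w where "w x = 1 / ((1 + \<bar>x\<bar>) * sqrt (1 + \<bar>x\<bar>))" for x :: real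
  have [measurable]: "w \<in> borel_measurable borel" unfolding w_def[abs_def] by measurable
  have w0: "w x \<ge> 0" for x by (simp add: w_def)
  have K0: "K \<ge> 0" by (simp add: K_def)
  have w_int: "(\<integral>\<^sup>+x. ennreal (w x) \<partial>lborel) \<le> 4"
    unfolding w_def by (rule nn_integral_three_halves_decay)
  have c2: "(cmod c)\<^sup>2 = 2"
    using arg_cong[OF assms(1), of cmod] by (simp add: norm_power norm_mult)
  have den: "(cmod (Complex x y + \<i>))\<^sup>2 = x\<^sup>2 + (1 + y)\<^sup>2" for x y
    by (simp add: cmod_power2 add.commute)
  have integrand: "(cmod (f (Complex x y) * alpha_inv_deriv_root c (Complex x y)))\<^sup>2
      = 2 * ((cmod (f (Complex x y)))\<^sup>2 / (x\<^sup>2 + (1 + y)\<^sup>2))" for x y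
    by (simp add: alpha_inv_deriv_root_def norm_mult norm_divide power_mult_distrib power_divide c2 den)
  have high: "(cmod (f (Complex x y)))\<^sup>2 / (x\<^sup>2 + (1 + y)\<^sup>2) \<le> K * w x" if y: "y \<ge> 1" for x y
  proof -
    have "cmod (f (Complex x y)) \<le> cmod (f \<i>) + cmod (f (Complex x y) - f \<i>)"
      using norm_triangle_ineq[of "f \<i>" "f (Complex x y) - f \<i>"] by simp
    also have "\<dots> \<le> cmod (f \<i>) + C * (1 + 2 * ln (y + \<bar>x\<bar>))"
      using bloch_log_growth[OF hol C y] by simp
    finally show ?thesis
      unfolding K_def w_def using y C(1) by (intro log_growth_square_le) auto
  qed
  have "(\<integral>\<^sup>+x. ennreal ((cmod (f (Complex x y) * alpha_inv_deriv_root c (Complex x y)))\<^sup>2) \<partial>lborel)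
      \<le> ennreal (4 * E + 64 * K)" if y: "y > 0" for y
  proof (cases "y \<ge> 1")
    case True
    have "(\<integral>\<^sup>+x. ennreal ((cmod (f (Complex x y) * alpha_inv_deriv_root c (Complex x y)))\<^sup>2) \<partial>lborel)
        \<le> (\<integral>\<^sup>+x. ennreal (2 * K) * ennreal (w x) \<partial>lborel)"
    proof (intro nn_integral_mono)
      fix x
      have "2 * ((cmod (f (Complex x y)))\<^sup>2 / (x\<^sup>2 + (1 + y)\<^sup>2)) \<le> 2 * (K * w x)"
        using high[OF True, of x] by (rule mult_left_mono) simp
      then have "ennreal (2 * ((cmod (f (Complex x y)))\<^sup>2 / (x\<^sup>2 + (1 + y)\<^sup>2))) \<le> ennreal ((2 * K) * w x)"
        by (intro ennreal_leI) (simp only: mult.assoc)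
      then show "ennreal ((cmod (f (Complex x y) * alpha_inv_deriv_root c (Complex x y)))\<^sup>2)
          \<le> ennreal (2 * K) * ennreal (w x)"
        unfolding integrand using K0 w0 by (simp only: ennreal_mult mult_nonneg_nonneg zero_le_numeral)
    qed
    also have "\<dots> = ennreal (2 * K) * (\<integral>\<^sup>+x. ennreal (w x) \<partial>lborel)"
      by (rule nn_integral_cmult) simp
    also have "\<dots> \<le> ennreal (2 * K) * ennreal 4"
      using w_int by (intro mult_left_mono) auto
    also have "\<dots> = ennreal (8 * K)"
      using K0 by (subst ennreal_mult[symmetric]) auto
    also have "\<dots> \<le> ennreal (4 * E + 64 * K)"
      using K0 E(2) by (intro ennreal_leI) simp
    finally show ?thesis .
  next
    case False
    define \<Delta> where "\<Delta> x = (cmod (f (Complex x y) - f (Complex x 1)))\<^sup>2" for x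
    have "continuous_on UNIV (\<lambda>x. f (Complex x b))" if "b > 0" for b
      by (rule continuous_on_compose2[OF holomorphic_on_imp_continuous_on[OF hol]])
         (use that in \<open>auto simp: Complex_eq upper_half_plane_def intro!: continuous_intros\<close>)
    then have "continuous_on UNIV \<Delta>"
      unfolding \<Delta>_def[abs_def] using y by (intro continuous_intros) auto
    then have [measurable]: "\<Delta> \<in> borel_measurable borel"
      by (rule borel_measurable_continuous_onI)
    \<comment> \<open>The increment needs no weight because \<open>x\<^sup>2 + (1 + y)\<^sup>2 \<ge> 1\<close>. For the value on the line of
      height 1, the weight at height \<open>y\<close> is at most 4 times the weight at height 1.\<close>
    have point: "2 * ((cmod (f (Complex x y)))\<^sup>2 / (x\<^sup>2 + (1 + y)\<^sup>2)) \<le> 4 * \<Delta> x + 16 * K * w x" for x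
    proof -
      define a b where "a = cmod (f (Complex x y) - f (Complex x 1))" and "b = cmod (f (Complex x 1))"
      have "cmod (f (Complex x y)) \<le> a + b"
        using norm_triangle_ineq[of "f (Complex x y) - f (Complex x 1)" "f (Complex x 1)"]
        by (simp add: a_def b_def)
      then have "(cmod (f (Complex x y)))\<^sup>2 \<le> (a + b)\<^sup>2"
        by (intro power_mono) auto
      also have "\<dots> \<le> 2 * a\<^sup>2 + 2 * b\<^sup>2"
        using sum_squares_bound[of a b] by (simp add: power2_sum)
      finally have num: "(cmod (f (Complex x y)))\<^sup>2 \<le> 2 * a\<^sup>2 + 2 * b\<^sup>2" .
      have "1 \<le> (1 + y)\<^sup>2" using y by (simp add: one_le_power)
      then have d1: "x\<^sup>2 + (1 + y)\<^sup>2 \<ge> 1" and d4: "x\<^sup>2 + (1 + y)\<^sup>2 \<ge> (x\<^sup>2 + (1 + 1)\<^sup>2) / 4"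
        by (auto simp: add_increasing) 
      have "2 * ((cmod (f (Complex x y)))\<^sup>2 / (x\<^sup>2 + (1 + y)\<^sup>2))
          \<le> 2 * ((2 * a\<^sup>2 + 2 * b\<^sup>2) / (x\<^sup>2 + (1 + y)\<^sup>2))"
        using num d1 by (intro mult_left_mono divide_right_mono) auto
      also have "\<dots> = 4 * (a\<^sup>2 / (x\<^sup>2 + (1 + y)\<^sup>2)) + 4 * (b\<^sup>2 / (x\<^sup>2 + (1 + y)\<^sup>2))"
        by (simp add: add_divide_distrib)
      also have "\<dots> \<le> 4 * (a\<^sup>2 / 1) + 4 * (b\<^sup>2 / ((x\<^sup>2 + (1 + 1)\<^sup>2) / 4))"
        using d1 d4 by (intro add_mono mult_left_mono divide_left_mono) (auto simp: add_nonneg_pos)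
      also have "\<dots> = 4 * a\<^sup>2 + 16 * (b\<^sup>2 / (x\<^sup>2 + (1 + 1)\<^sup>2))" by simp
      also have "\<dots> \<le> 4 * a\<^sup>2 + 16 * (K * w x)"
        using high[of 1 x] by (simp add: b_def)
      finally show ?thesis by (simp add: \<Delta>_def a_def)
    qed
    have "(\<integral>\<^sup>+x. ennreal ((cmod (f (Complex x y) * alpha_inv_deriv_root c (Complex x y)))\<^sup>2) \<partial>lborel)
        \<le> (\<integral>\<^sup>+x. 4 * ennreal (\<Delta> x) + ennreal (16 * K) * ennreal (w x) \<partial>lborel)"
    proof (intro nn_integral_mono)
      fix x
      have "4 * ennreal (\<Delta> x) + ennreal (16 * K) * ennreal (w x) = ennreal (4 * \<Delta> x + 16 * K * w x)"
        using K0 w0 by (simp add: \<Delta>_def ennreal_mult ennreal_plus)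
      then show "ennreal ((cmod (f (Complex x y) * alpha_inv_deriv_root c (Complex x y)))\<^sup>2)
          \<le> 4 * ennreal (\<Delta> x) + ennreal (16 * K) * ennreal (w x)"
        unfolding integrand using point by (simp add: ennreal_leI)
    qed
    also have "\<dots> = 4 * (\<integral>\<^sup>+x. ennreal (\<Delta> x) \<partial>lborel) + ennreal (16 * K) * (\<integral>\<^sup>+x. ennreal (w x) \<partial>lborel)"
      by (simp add: nn_integral_add nn_integral_cmult)
    also have "\<dots> \<le> 4 * ennreal E + ennreal (16 * K) * ennreal 4"
      using dirichlet_vertical_increment[OF hol y] False w_int
      by (intro add_mono mult_left_mono) (auto simp: \<Delta>_def E(1))
    also have "ennreal (16 * K) * ennreal 4 = ennreal (64 * K)"
      using K0 by (subst ennreal_mult[symmetric]) auto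
    also have "4 * ennreal E = ennreal (4 * E)"
      by (simp add: ennreal_mult')
    also have "ennreal (4 * E) + ennreal (64 * K) = ennreal (4 * E + 64 * K)"
      using K0 E(2) by (simp add: ennreal_plus)
    finally show ?thesis .
  qed
  then have "hardy_norm (\<lambda>z. f z * alpha_inv_deriv_root c z) < \<infinity>"
    using K0 E(2) by (intro hardy_norm_finiteI[of "4 * E + 64 * K"]) auto
  then show ?thesis
    using hol alpha_inv_deriv_root_holomorphic[of c]
    by (auto simp: hardy_space_def intro!: holomorphic_on_mult)
qed

end
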